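(* Let $(\mathfrak g,[\cdot,\cdot]_{\mathfrak g})$ be a Leibniz algebra with left center $\mathrm Z(\mathfrak g)$. Consider the graded vector space $\mathcal G=\mathrm Z(\mathfrak g)\oplus\mathfrak g$, with $\mathrm Z(\mathfrak g)$ in degree $1$ and $\mathfrak g$ in degree $0$. Let $l_1:\mathrm Z(\mathfrak g)\to\mathfrak g$ be the inclusion, let $l_2$ be the skew-symmetric bilinear map of degree $0$ given by $$l_2(x,y)=\tfrac12([x,y]_{\mathfrak g}-[y,x]_{\mathfrak g}),\qquad l_2(x,c)=-l_2(c,x)=\tfrac12[x,c]_{\mathfrak g},\qquad l_2(c_1,c_2)=0$$ for $x,y\in\mathfrak g$ and $c,c_1,c_2\in\mathrm Z(\mathfrak g)$ (with $x,y$ regarded in degree $0$ and $c,c_1,c_2$ in degree $1$), and let $l_3$ be the totally skew-symmetric trilinear map of degree $1$ given by $$l_3(x,y,z)=J_{x,y,z},\qquad x,y,z\in\mathfrak g .$$ Then $(\mathcal G,l_1,l_2,l_3)$ is a Lie $2$-algebra.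
   Context: All vector spaces are over $\mathbb R$. A Leibniz algebra is a vector space $\mathfrak g$ with a linear map $[\cdot,\cdot]_{\mathfrak g}:\mathfrak g\otimes\mathfrak g\to\mathfrak g$ satisfying $[x,[y,z]_{\mathfrak g}]_{\mathfrak g}=[[x,y]_{\mathfrak g},z]_{\mathfrak g}+[y,[x,z]_{\mathfrak g}]_{\mathfrak g}$ for all $x,y,z\in\mathfrak g$. Its left center is $\mathrm Z(\mathfrak g)=\{x\in\mathfrak g\mid [x,y]_{\mathfrak g}=0\ \ \forall y\in\mathfrak g\}$; it is an ideal. Write $[x,y]_{\mathrm{sk}}=\tfrac12([x,y]_{\mathfrak g}-[y,x]_{\mathfrak g})$ for the skew-symmetrized bracket, and $J_{x,y,z}=[x,[y,z]_{\mathrm{sk}}]_{\mathrm{sk}}+[y,[z,x]_{\mathrm{sk}}]_{\mathrm{sk}}+[z,[x,y]_{\mathrm{sk}}]_{\mathrm{sk}}$ for its Jacobiator. A Lie $2$-algebra is a graded vector space $\mathfrak h=\mathfrak h_1\oplus\mathfrak h_0$ with linear maps $l_k:\wedge^k\mathfrak h\to\mathfrak h$, $k=1,2,3$, of degree $k-2$, i.e. $l_1:\mathfrak h_1\to\mathfrak h_0$; $l_2$ skew-symmetric with components $\mathfrak h_0\times\mathfrak h_0\to\mathfrak h_0$ and $\mathfrak h_0\times\mathfrak h_1\to\mathfrak h_1$ (where $l_2(a,x)=-l_2(x,a)$), zero on $\mathfrak h_1\times\mathfrak h_1$; $l_3:\wedge^3\mathfrak h_0\to\mathfrak h_1$ totally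 skew-symmetric; such that for all $x,y,z,w\in\mathfrak h_0$, $a,b\in\mathfrak h_1$: (a) $l_1l_2(x,a)=l_2(x,l_1(a))$; (b) $l_2(l_1(a),b)=l_2(a,l_1(b))$; (c) $l_2(x,l_2(y,z))+l_2(y,l_2(z,x))+l_2(z,l_2(x,y))=l_1l_3(x,y,z)$; (d) $l_2(x,l_2(y,a))+l_2(y,l_2(a,x))+l_2(a,l_2(x,y))=l_3(x,y,l_1(a))$; (e) $l_2(x,l_3(y,z,w))-l_2(y,l_3(x,z,w))+l_2(z,l_3(x,y,w))-l_2(w,l_3(x,y,z))-l_3(l_2(x,y),z,w)+l_3(l_2(x,z),y,w)-l_3(l_2(x,w),y,z)-l_3(l_2(y,z),x,w)+l_3(l_2(y,w),x,z)-l_3(l_2(z,w),x,y)=0$. *)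

theory Defs
  imports "HOL-Analysis.Analysis"
begin

locale leibniz_algebra =
  fixes bracket :: "'a::real_vector \<Rightarrow> 'a \<Rightarrow> 'a"
  assumes bilinear_bracket: "bilinear bracket"
    and leibniz: "bracket x (bracket y z) = bracket (bracket x y) z + bracket y (bracket x z)"

definition left_center :: "('a::real_vector \<Rightarrow> 'a \<Rightarrow> 'a) \<Rightarrow> 'a set" where
  "left_center bracket = {x. \<forall>y. bracket x y = 0}"

definition skew_bracket :: "('a::real_vector \<Rightarrow> 'a \<Rightarrow> 'a) \<Rightarrow> 'a \<Rightarrow> 'a \<Rightarrow> 'a" where
  "skew_bracket bracket x y = (1/2) *\<^sub>R (bracket x y - bracket y x)"

definition jacobiator :: "('a::real_vector \<Rightarrow> 'a \<Rightarrow> 'a) \<Rightarrow> 'a \<Rightarrow> 'a \<Rightarrow> 'a \<Rightarrow> 'a" where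
  "jacobiator bracket x y z =
     skew_bracket bracket x (skew_bracket bracket y z)
   + skew_bracket bracket y (skew_bracket bracket z x)
   + skew_bracket bracket z (skew_bracket bracket x y)"

text \<open>Linearity of a map between subspaces \<open>V\<close> and \<open>W\<close>; nothing is said about its values
  outside \<open>V\<close>.\<close>

definition linear_between :: "'v::real_vector set \<Rightarrow> 'w::real_vector set \<Rightarrow> ('v \<Rightarrow> 'w) \<Rightarrow> bool" where
  "linear_between V W f \<longleftrightarrow>
     (\<forall>x\<in>V. f x \<in> W) \<and>
     (\<forall>x\<in>V. \<forall>y\<in>V. f (x + y) = f x + f y) \<and>
     (\<forall>r. \<forall>x\<in>V. f (r *\<^sub>R x) = r *\<^sub>R f x)"

definition subspace_sum :: "'v::real_vector set \<Rightarrow> 'v set \<Rightarrow> 'v set" where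
  "subspace_sum V W = {v + w | v w. v \<in> V \<and> w \<in> W}"

text \<open>The graded vector space is the internal direct sum \<open>h = h1 \<oplus> h0\<close> of two subspaces of an
  ambient real vector space, and the maps \<open>l1\<close>, \<open>l2\<close>, \<open>l3\<close> are multilinear on all of \<open>h\<close>. Having
  degree \<open>k - 2\<close> forces \<open>l1\<close> to vanish on \<open>h0\<close>, \<open>l2\<close> to vanish on \<open>h1 \<times> h1\<close>, and \<open>l3\<close> to
  vanish as soon as one argument lies in \<open>h1\<close>. By skew-symmetry it suffices to state the
  degree conditions for one order of the arguments.\<close>

locale lie_2_algebra =
  fixes h1 h0 :: "'v::real_vector set"
    and l1 :: "'v \<Rightarrow> 'v"
    and l2 :: "'v \<Rightarrow> 'v \<Rightarrow> 'v"
    and l3 :: "'v \<Rightarrow> 'v \<Rightarrow> 'v \<Rightarrow> 'v"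
    and h :: "'v set"
  defines "h \<equiv> subspace_sum h1 h0"
  assumes subspaces: "subspace h1" "subspace h0"
    and direct: "h1 \<inter> h0 = {0}"
    and l1_linear: "linear_between h h l1"
    and l1_degree: "a \<in> h1 \<Longrightarrow> l1 a \<in> h0" "x \<in> h0 \<Longrightarrow> l1 x = 0"
    and l2_linear: "u \<in> h \<Longrightarrow> linear_between h h (\<lambda>v. l2 u v)"
      "v \<in> h \<Longrightarrow> linear_between h h (\<lambda>u. l2 u v)"
    and l2_skew: "u \<in> h \<Longrightarrow> v \<in> h \<Longrightarrow> l2 u v = - l2 v u"
    and l2_degree: "x \<in> h0 \<Longrightarrow> y \<in> h0 \<Longrightarrow> l2 x y \<in> h0"
      "x \<in> h0 \<Longrightarrow> a \<in> h1 \<Longrightarrow> l2 x a \<in> h1"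
      "a \<in> h1 \<Longrightarrow> b \<in> h1 \<Longrightarrow> l2 a b = 0"
    and l3_linear: "v \<in> h \<Longrightarrow> w \<in> h \<Longrightarrow> linear_between h h (\<lambda>u. l3 u v w)"
      "u \<in> h \<Longrightarrow> w \<in> h \<Longrightarrow> linear_between h h (\<lambda>v. l3 u v w)"
      "u \<in> h \<Longrightarrow> v \<in> h \<Longrightarrow> linear_between h h (\<lambda>w. l3 u v w)"
    and l3_skew: "u \<in> h \<Longrightarrow> v \<in> h \<Longrightarrow> w \<in> h \<Longrightarrow> l3 u v w = - l3 v u w"
      "u \<in> h \<Longrightarrow> v \<in> h \<Longrightarrow> w \<in> h \<Longrightarrow> l3 u v w = - l3 u w v"
    and l3_degree: "x \<in> h0 \<Longrightarrow> y \<in> h0 \<Longrightarrow> z \<in> h0 \<Longrightarrow> l3 x y z \<in> h1"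
      "a \<in> h1 \<Longrightarrow> v \<in> h \<Longrightarrow> w \<in> h \<Longrightarrow> l3 a v w = 0"
    and l1_l2: "x \<in> h0 \<Longrightarrow> a \<in> h1 \<Longrightarrow> l1 (l2 x a) = l2 x (l1 a)"
    and l2_l1: "a \<in> h1 \<Longrightarrow> b \<in> h1 \<Longrightarrow> l2 (l1 a) b = l2 a (l1 b)"
    and jacobi_0: "x \<in> h0 \<Longrightarrow> y \<in> h0 \<Longrightarrow> z \<in> h0 \<Longrightarrow>
      l2 x (l2 y z) + l2 y (l2 z x) + l2 z (l2 x y) = l1 (l3 x y z)"
    and jacobi_1: "x \<in> h0 \<Longrightarrow> y \<in> h0 \<Longrightarrow> a \<in> h1 \<Longrightarrow>
      l2 x (l2 y a) + l2 y (l2 a x) + l2 a (l2 x y) = l3 x y (l1 a)"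
    and coherence: "x \<in> h0 \<Longrightarrow> y \<in> h0 \<Longrightarrow> z \<in> h0 \<Longrightarrow> w \<in> h0 \<Longrightarrow>
      l2 x (l3 y z w) - l2 y (l3 x z w) + l2 z (l3 x y w) - l2 w (l3 x y z)
      - l3 (l2 x y) z w + l3 (l2 x z) y w - l3 (l2 x w) y z
      - l3 (l2 y z) x w + l3 (l2 y w) x z - l3 (l2 z w) x y = 0"

text \<open>\<open>Z(g) \<oplus> g\<close> is realised inside \<open>'a \<times> 'a\<close>: the pair \<open>(c, x)\<close> has degree-1 component \<open>c\<close>
  and degree-0 component \<open>x\<close>.\<close>

definition deg1 :: "'a::real_vector \<Rightarrow> 'a \<times> 'a" where "deg1 c = (c, 0)"
definition deg0 :: "'a::real_vector \<Rightarrow> 'a \<times> 'a" where "deg0 x = (0, x)"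

definition leibniz_l1 :: "'a::real_vector \<times> 'a \<Rightarrow> 'a \<times> 'a" where
  "leibniz_l1 = (\<lambda>(c, x). deg0 c)"

text \<open>Bilinear extensions to pairs of the formulas on homogeneous elements; the lemmas below
  recover the latter.\<close>

definition leibniz_l2 ::
    "('a::real_vector \<Rightarrow> 'a \<Rightarrow> 'a) \<Rightarrow> 'a \<times> 'a \<Rightarrow> 'a \<times> 'a \<Rightarrow> 'a \<times> 'a" where
  "leibniz_l2 bracket = (\<lambda>(c, x) (d, y).
     deg0 ((1/2) *\<^sub>R (bracket x y - bracket y x))
   + deg1 ((1/2) *\<^sub>R bracket x d) - deg1 ((1/2) *\<^sub>R bracket y c))"

definition leibniz_l3 ::
    "('a::real_vector \<Rightarrow> 'a \<Rightarrow> 'a) \<Rightarrow> 'a \<times> 'a \<Rightarrow> 'a \<times> 'a \<Rightarrow> 'a \<times> 'a \<Rightarrow> 'a \<times> 'a" where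
  "leibniz_l3 bracket = (\<lambda>(_, x) (_, y) (_, z). deg1 (jacobiator bracket x y z))"

lemma leibniz_l1_homogeneous:
  "leibniz_l1 (deg1 c) = deg0 c"
  "leibniz_l1 (deg0 x) = 0"
  by (simp_all add: leibniz_l1_def deg0_def deg1_def zero_prod_def)

context leibniz_algebra
begin

lemma leibniz_l2_homogeneous:
  "leibniz_l2 bracket (deg0 x) (deg0 y) = deg0 ((1/2) *\<^sub>R (bracket x y - bracket y x))"
  "leibniz_l2 bracket (deg0 x) (deg1 c) = deg1 ((1/2) *\<^sub>R bracket x c)"
  "leibniz_l2 bracket (deg1 c) (deg0 x) = - deg1 ((1/2) *\<^sub>R bracket x c)"
  "leibniz_l2 bracket (deg1 c) (deg1 d) = 0"
  using bilinear_bracket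
  by (simp_all add: leibniz_l2_def deg0_def deg1_def zero_prod_def bilinear_lzero bilinear_rzero)

lemma leibniz_l3_homogeneous:
  "leibniz_l3 bracket (deg0 x) (deg0 y) (deg0 z) = deg1 (jacobiator bracket x y z)"
  "leibniz_l3 bracket (deg1 c) v w = 0"
  "leibniz_l3 bracket u (deg1 c) w = 0"
  "leibniz_l3 bracket u v (deg1 c) = 0"
  using bilinear_bracket
  by (simp_all add: leibniz_l3_def deg0_def deg1_def zero_prod_def jacobiator_def
      skew_bracket_def bilinear_lzero bilinear_rzero bilinear_lneg bilinear_rneg
      bilinear_lsub bilinear_rsub split: prod.splits)

end

end

theory Submission
  imports Defs
begin

text \<open>The left center is an ideal, so \<open>l2\<close> takes values in the graded space. Beyond that, only the
  target of \<open>l3\<close> and the coherence axiom carry content, and they rest on different facts.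

  The Leibniz identity says that left multiplication \<open>L x = bracket x\<close> satisfies
  \<open>L (bracket x y) = L x \<circ> L y - L y \<circ> L x\<close>. The right-hand side is antisymmetric, so skew-symmetrizing the
  bracket leaves the operator \<open>L (bracket x y)\<close> unchanged, and \<open>L\<close> turns the skew bracket into the
  commutator of operators. Commutators satisfy the Jacobi identity, hence \<open>L\<close> annihilates the
  Jacobiator: it lies in the left center (\<open>jacobiator_in_left_center\<close>), and \<open>l3\<close> has the right target.

  On the left center, \<open>L c = 0\<close> makes \<open>(1/2) bracket x c\<close> equal to the skew bracket of \<open>x\<close> and \<open>c\<close>.
  So every component of \<open>l2\<close>, including the one with an argument in degree 1, is the skew bracket,
  and \<open>l1\<close> is an inclusion. The two Jacobi axioms then merely restate the definition of the
  Jacobiator. The coherence axiom becomes a statement about the skew bracket alone, and it holds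
  for every skew-symmetric bilinear operation \<open>m\<close> (\<open>jacobiator_coherence\<close>): it is the Bianchi identity
  \<open>[m, [m, m]] = 0\<close> for the Nijenhuis-Richardson bracket.\<close>

section \<open>The Jacobiator of a bilinear operation\<close>

lemma skew_bracket_skew: "skew_bracket bracket x y = - skew_bracket bracket y x"
  by (simp add: skew_bracket_def algebra_simps)

lemma bilinear_skew_bracket:
  assumes "bilinear bracket"
  shows "bilinear (skew_bracket bracket)"
  using assms unfolding skew_bracket_def bilinear_def linear_iff
  by (simp add: algebra_simps)

lemma jacobiator_swap:
  assumes "bilinear bracket"
  shows "jacobiator bracket x y z = - jacobiator bracket y x z"
    and "jacobiator bracket x y z = - jacobiator bracket x z y"
  unfolding jacobiator_def
  using bilinear_rneg[OF bilinear_skew_bracket[OF assms]] skew_bracket_skew[of bracket]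
  by (metis (no_types, lifting) add.assoc add.commute minus_add_distrib)+

lemma jacobiator_linear:
  assumes "bilinear bracket"
  shows "linear (\<lambda>x. jacobiator bracket x y z)"
    and "linear (\<lambda>y. jacobiator bracket x y z)"
    and "linear (\<lambda>z. jacobiator bracket x y z)"
  using bilinear_skew_bracket[OF assms] unfolding jacobiator_def bilinear_def linear_iff
  by (simp_all add: algebra_simps)

text \<open>Expanding the Jacobiators leaves iterated brackets of the two shapes \<open>m p (m q (m r s))\<close> and
  \<open>m (m p q) (m r s)\<close>. Each one of the first shape comes once from bracketing with a Jacobiator and
  once from inserting a bracket into a Jacobiator, with opposite signs; those of the second shape
  cancel in pairs, because the pairs \<open>(p, q)\<close> and \<open>(r, s)\<close> exchange roles.\<close>

lemma jacobiator_coherence: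
  fixes bracket :: "'a::real_vector \<Rightarrow> 'a \<Rightarrow> 'a"
  assumes "bilinear bracket"
  defines "m \<equiv> skew_bracket bracket" and "J \<equiv> jacobiator bracket"
  shows "m x (J y z w) - m y (J x z w) + m z (J x y w) - m w (J x y z)
      - J (m x y) z w + J (m x z) y w - J (m x w) y z
      - J (m y z) x w + J (m y w) x z - J (m z w) x y = 0"
proof -
  have bil: "bilinear m"
    unfolding m_def by (rule bilinear_skew_bracket[OF assms(1)])
  have skew: "m p q = - m q p" for p q
    unfolding m_def by (rule skew_bracket_skew)
  note bil_simps = bilinear_radd[OF bil] bilinear_rsub[OF bil]
    bilinear_rneg[OF bil] bilinear_lneg[OF bil]
  have J: "J p q r = m p (m q r) + m q (m r p) + m r (m p q)" for p q r
    unfolding J_def m_def jacobiator_def by simp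
  \<comment> \<open>Skew-symmetry as a rewrite rule would loop. These instances bring every iterated bracket
    into a normal form: two variables in a bracket follow the order \<open>x, y, z, w\<close>, a bracket
    stands to the right of a variable, and of two brackets the one with \<open>x\<close> comes first.\<close>
  have inner: "m z y = - m y z" "m w z = - m z w" "m w y = - m y w"
      "m z x = - m x z" "m w x = - m x w" "m y x = - m x y"
    by (rule skew)+
  have nested_x: "m (m p q) x = - m x (m p q)"
    and nested_y: "m (m p q) y = - m y (m p q)"
    and nested_z: "m (m p q) z = - m z (m p q)"
    and nested_w: "m (m p q) w = - m w (m p q)" for p q
    by (rule skew)+
  have outer: "m (m z w) (m x y) = - m (m x y) (m z w)"
      "m (m y w) (m x z) = - m (m x z) (m y w)"
      "m (m y z) (m x w) = - m (m x w) (m y z)"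
    by (rule skew)+
  show ?thesis
    unfolding J
    by (simp add: bil_simps inner nested_x nested_y nested_z nested_w outer algebra_simps)
qed

section \<open>The left center of a Leibniz algebra\<close>

lemma subspace_left_center:
  assumes "bilinear bracket"
  shows "subspace (left_center bracket)"
  using assms
  by (auto simp: subspace_def left_center_def bilinear_ladd bilinear_lmul bilinear_lzero)

lemma skew_bracket_left_center:
  assumes "c \<in> left_center bracket"
  shows "skew_bracket bracket x c = (1/2) *\<^sub>R bracket x c"
  using assms by (simp add: skew_bracket_def left_center_def)

context leibniz_algebra
begin

lemma bracket_left_center:
  assumes "c \<in> left_center bracket"
  shows "bracket x c \<in> left_center bracket"
proof -
  have "bracket (bracket x c) y = 0" for y
    using leibniz[of x c y] assms bilinear_rzero[OF bilinear_bracket]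
    by (simp add: left_center_def)
  then show ?thesis
    by (simp add: left_center_def)
qed

text \<open>The Leibniz identity makes left multiplication by \<open>bracket x y\<close> a commutator, which is already
  antisymmetric in \<open>x\<close> and \<open>y\<close>, so the skew bracket acts in the same way.\<close>

lemma left_mult_skew_bracket:
  "bracket (skew_bracket bracket x y) v = bracket x (bracket y v) - bracket y (bracket x v)"
proof -
  have comm: "bracket (bracket p q) v = bracket p (bracket q v) - bracket q (bracket p v)" for p q
    using leibniz[of p q v] by simp
  have anti: "bracket (bracket y x) v = - bracket (bracket x y) v"
    by (simp add: comm)
  have "bracket (skew_bracket bracket x y) v
      = (1/2) *\<^sub>R (bracket (bracket x y) v - bracket (bracket y x) v)"
    by (simp add: skew_bracket_def bilinear_lmul[OF bilinear_bracket]
        bilinear_lsub[OF bilinear_bracket])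
  also have "\<dots> = bracket (bracket x y) v"
    by (simp add: anti)
  finally show ?thesis
    by (simp add: comm)
qed

text \<open>Left multiplication sends the Jacobiator to the cyclic sum of iterated commutators of
  operators, which is zero.\<close>

lemma jacobiator_in_left_center: "jacobiator bracket x y z \<in> left_center bracket"
  by (simp add: left_center_def jacobiator_def left_mult_skew_bracket
      bilinear_ladd[OF bilinear_bracket] bilinear_rsub[OF bilinear_bracket])

end

section \<open>The Lie 2-algebra of a Leibniz algebra\<close>

lemma subspace_sum_deg: "subspace_sum (deg1 ` C) (deg0 ` UNIV) = C \<times> UNIV"
  by (force simp: subspace_sum_def deg0_def deg1_def)

lemma leibniz_l2_Pair:
  "leibniz_l2 bracket (c, x) (d, y)
     = ((1/2) *\<^sub>R (bracket x d - bracket y c), skew_bracket bracket x y)"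
  by (simp add: leibniz_l2_def deg0_def deg1_def skew_bracket_def scaleR_diff_right)

text \<open>On two arguments of degree 0, and on one of degree 0 and one of degree 1, \<open>l2\<close> is the skew
  bracket of the underlying elements; this turns the Jacobi and coherence axioms into identities
  for the skew bracket.\<close>

lemma leibniz_l2_skew_bracket:
  assumes "bilinear bracket"
  shows "leibniz_l2 bracket (deg0 x) (deg0 y) = deg0 (skew_bracket bracket x y)"
    and "c \<in> left_center bracket \<Longrightarrow>
      leibniz_l2 bracket (deg0 x) (deg1 c) = deg1 (skew_bracket bracket x c)"
    and "c \<in> left_center bracket \<Longrightarrow>
      leibniz_l2 bracket (deg1 c) (deg0 x) = deg1 (skew_bracket bracket c x)"
  using bilinear_rzero[OF assms] bilinear_lzero[OF assms]
  by (simp_all add: deg0_def deg1_def leibniz_l2_Pair left_center_def skew_bracket_def)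

lemma deg_linear: "linear deg0" "linear deg1"
  by (simp_all add: linear_iff deg0_def deg1_def)

theorem theorem1p3:
  fixes bracket :: "'a::real_vector \<Rightarrow> 'a \<Rightarrow> 'a"
  assumes "leibniz_algebra bracket"
  shows "lie_2_algebra (deg1 ` left_center bracket) (deg0 ` UNIV)
           leibniz_l1 (leibniz_l2 bracket) (leibniz_l3 bracket)"
proof -
  interpret leibniz_algebra bracket by (rule assms)
  let ?Z = "left_center bracket" and ?m = "skew_bracket bracket" and ?J = "jacobiator bracket"
  let ?h = "subspace_sum (deg1 ` ?Z) (deg0 ` UNIV)"
  note bil = bilinear_bracket
  note J_linear = jacobiator_linear[OF bil]
  note Z_subspace = subspace_left_center[OF bil]
  note Z_closed = subspace_scale[OF Z_subspace] subspace_diff[OF Z_subspace]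
    subspace_0[OF Z_subspace] bracket_left_center jacobiator_in_left_center
  have skew_in_Z: "?m x c \<in> ?Z" if "c \<in> ?Z" for x c
    using that by (simp add: skew_bracket_left_center Z_closed)
  have skew_in_Z': "?m c x \<in> ?Z" if "c \<in> ?Z" for x c
    using subspace_neg[OF Z_subspace skew_in_Z[OF that]] by (simp flip: skew_bracket_skew)
  note l2_simps = leibniz_l2_skew_bracket[OF bil]
  have l3_deg0: "leibniz_l3 bracket (deg0 x) (deg0 y) (deg0 z) = deg1 (?J x y z)" for x y z
    by (rule leibniz_l3_homogeneous)
  have l2_skew: "leibniz_l2 bracket u v = - leibniz_l2 bracket v u" for u v
    by (cases u; cases v)
      (simp add: leibniz_l2_Pair skew_bracket_def algebra_simps)
  have l2_linear: "linear_between ?h ?h (leibniz_l2 bracket u)" if "u \<in> ?h" for u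
    using that bil
    by (cases u) (auto simp: linear_between_def subspace_sum_deg leibniz_l2_Pair Z_closed
        skew_bracket_def bilinear_ladd bilinear_radd bilinear_lmul bilinear_rmul algebra_simps
        intro!: Z_closed)
  have l2_linear': "linear_between ?h ?h (\<lambda>u. leibniz_l2 bracket u v)" if "v \<in> ?h" for v
  proof -
    have "linear_between ?h ?h (\<lambda>u. - leibniz_l2 bracket v u)"
      using l2_linear[OF that] subspace_neg[OF Z_subspace]
      unfolding linear_between_def subspace_sum_deg by (auto simp: mem_Times_iff)
    then show ?thesis
      by (subst l2_skew)
  qed
  have l3_linear: "linear_between ?h ?h (\<lambda>u. leibniz_l3 bracket u v w)"
    "linear_between ?h ?h (\<lambda>u. leibniz_l3 bracket v u w)"
    "linear_between ?h ?h (\<lambda>u. leibniz_l3 bracket v w u)" for v w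
    unfolding subspace_sum_deg
    by (simp_all add: linear_between_def leibniz_l3_def deg1_def jacobiator_in_left_center
        linear_add[OF J_linear(1)] linear_add[OF J_linear(2)] linear_add[OF J_linear(3)]
        linear_scale[OF J_linear(1)] linear_scale[OF J_linear(2)] linear_scale[OF J_linear(3)]
        split: prod.split)
  have l3_skew: "leibniz_l3 bracket u v w = - leibniz_l3 bracket v u w"
    "leibniz_l3 bracket u v w = - leibniz_l3 bracket u w v" for u v w
    by (auto simp: leibniz_l3_def deg1_def split: prod.split intro: jacobiator_swap[OF bil])
  show ?thesis
  proof (unfold_locales, goal_cases)
    case 1
    show ?case by (intro linear_subspace_image deg_linear Z_subspace)
  next
    case 2
    show ?case by (intro linear_subspace_image deg_linear subspace_UNIV)
  next
    case 3
    show ?case using Z_closed(3) by (auto simp: deg0_def deg1_def zero_prod_def)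
  next
    case 4
    show ?case
      unfolding subspace_sum_deg
      by (auto simp: linear_between_def leibniz_l1_def deg0_def Z_closed)
  next
    case (5 a)
    then show ?case by (auto simp: leibniz_l1_homogeneous)
  next
    case (6 x)
    then show ?case by (auto simp: leibniz_l1_homogeneous)
  next
    case (7 u)
    then show ?case by (rule l2_linear)
  next
    case (8 v)
    then show ?case by (rule l2_linear')
  next
    case (9 u v)
    show ?case by (rule l2_skew)
  next
    case (10 x y)
    then show ?case by (auto simp: l2_simps)
  next
    case (11 x a)
    then show ?case by (auto simp: l2_simps skew_in_Z)
  next
    case (12 a b)
    then show ?case by (auto simp: leibniz_l2_homogeneous)
  next
    case (13 v w)
    show ?case by (rule l3_linear)
  next
    case (14 u w)
    show ?case by (rule l3_linear)
  next
    case (15 u v)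
    show ?case by (rule l3_linear)
  next
    case (16 u v w)
    show ?case by (rule l3_skew)
  next
    case (17 u v w)
    show ?case by (rule l3_skew)
  next
    case (18 x y z)
    then show ?case by (auto simp: l3_deg0 Z_closed)
  next
    case (19 a v w)
    then show ?case by (auto simp: leibniz_l3_homogeneous)
  next
    case (20 x a)
    then show ?case by (auto simp: l2_simps skew_in_Z leibniz_l1_homogeneous)
  next
    case (21 a b)
    then show ?case
      by (auto simp: l2_simps leibniz_l1_homogeneous skew_bracket_def left_center_def)
  next
    case (22 x y z)
    then show ?case
      by (auto simp: l2_simps l3_deg0 leibniz_l1_homogeneous jacobiator_def
          simp flip: linear_add[OF deg_linear(1)])
  next
    case (23 x y a)
    then show ?case
      by (auto simp: l2_simps l3_deg0 skew_in_Z skew_in_Z' leibniz_l1_homogeneous jacobiator_def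
          simp flip: linear_add[OF deg_linear(2)])
  next
    case (24 x y z w)
    then obtain x' y' z' w' where
      [simp]: "x = deg0 x'" "y = deg0 y'" "z = deg0 z'" "w = deg0 w'"
      by auto
    show ?case
      using jacobiator_coherence[OF bil, of x' y' z' w']
      by (simp add: l2_simps l3_deg0 jacobiator_in_left_center linear_0[OF deg_linear(2)]
          flip: linear_add[OF deg_linear(2)] linear_diff[OF deg_linear(2)])
  qed
qed

end
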